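(* There exist a finite-dimensional Hilbert space $\mathcal{H}_A$ and a unital quantum map $\Phi$ on operators on $\mathcal{H}_A$ that is not catalytic; that is, not every unital map is catalytic.
   Context: All Hilbert spaces are finite-dimensional. A quantum map (channel) is a completely positive trace-preserving linear map on operators; it is unital if it preserves the maximally mixed state. Let $A$ be a system with Hilbert space $\mathcal{H}_A$. A quantum map $\Phi$ on $A$ is called catalytic if there exist a finite-dimensional system $B$, a quantum state $\sigma_B$ on $B$ (the catalyst), a unitary $U$ on $\mathcal{H}_A\otimes\mathcal{H}_B$ and a unitary $V$ on $\mathcal{H}_B$ such that for all states $\rho$ on $A$: $\mathrm{Tr}_B\,U(\rho_A\otimes\sigma_B)U^\dagger=\Phi(\rho)$ and $\mathrm{Tr}_A\,U(\rho_A\otimes\sigma_B)U^\dagger=V\sigma_BV^\dagger$. *)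

theory Defs
  imports "Jordan_Normal_Form.Schur_Decomposition"
begin

text \<open>
  A finite-dimensional Hilbert space is \<open>\<complex>\<^sup>n\<close>, and its operators are the complex
  \<open>n \<times> n\<close> matrices. Dimensions are natural numbers rather than types, because being catalytic
  quantifies existentially over the catalyst system.
\<close>

definition unitary_op :: "nat \<Rightarrow> complex mat \<Rightarrow> bool" where
  "unitary_op n U \<longleftrightarrow> U \<in> carrier_mat n n \<and>
     mat_adjoint U * U = 1\<^sub>m n \<and> U * mat_adjoint U = 1\<^sub>m n"

definition trace_op :: "complex mat \<Rightarrow> complex" where
  "trace_op X = (\<Sum>i<dim_row X. X $$ (i, i))"

text \<open>
  In the order on \<open>complex\<close> from \<^theory>\<open>HOL-Library.Complex_Order\<close>, \<open>0 \<le> z\<close> means that \<open>z\<close> is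
  real and nonnegative; positive operators are therefore automatically Hermitian.
\<close>

definition positive_op :: "nat \<Rightarrow> complex mat \<Rightarrow> bool" where
  "positive_op n X \<longleftrightarrow> X \<in> carrier_mat n n \<and>
     (\<forall>v \<in> carrier_vec n. 0 \<le> (X *\<^sub>v v) \<bullet>c v)"

definition quantum_state :: "nat \<Rightarrow> complex mat \<Rightarrow> bool" where
  "quantum_state n \<rho> \<longleftrightarrow> positive_op n \<rho> \<and> trace_op \<rho> = 1"

definition maximally_mixed :: "nat \<Rightarrow> complex mat" where
  "maximally_mixed n = (1 / of_nat n) \<cdot>\<^sub>m 1\<^sub>m n"

text \<open>
  The basis vector \<open>e\<^sub>i \<otimes> f\<^sub>a\<close> of \<open>\<complex>\<^sup>n \<otimes> \<complex>\<^sup>m\<close> is the basis vector of \<open>\<complex>\<^sup>n\<^sup>m\<close> with index \<open>i * m + a\<close>.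
\<close>

definition tensor_op :: "complex mat \<Rightarrow> complex mat \<Rightarrow> complex mat" where
  "tensor_op X Y = mat (dim_row X * dim_row Y) (dim_col X * dim_col Y)
     (\<lambda>(r, c). X $$ (r div dim_row Y, c div dim_col Y) * Y $$ (r mod dim_row Y, c mod dim_col Y))"

text \<open>Partial traces of operators on \<open>\<complex>\<^sup>n \<otimes> \<complex>\<^sup>m\<close>, over the first and over the second factor.\<close>

definition ptrace_fst :: "nat \<Rightarrow> nat \<Rightarrow> complex mat \<Rightarrow> complex mat" where
  "ptrace_fst n m X = mat m m (\<lambda>(a, b). \<Sum>i<n. X $$ (i * m + a, i * m + b))"

definition ptrace_snd :: "nat \<Rightarrow> nat \<Rightarrow> complex mat \<Rightarrow> complex mat" where
  "ptrace_snd n m X = mat n n (\<lambda>(i, j). \<Sum>a<m. X $$ (i * m + a, j * m + a))"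

definition linear_map_op :: "nat \<Rightarrow> (complex mat \<Rightarrow> complex mat) \<Rightarrow> bool" where
  "linear_map_op n \<Phi> \<longleftrightarrow>
     (\<forall>X \<in> carrier_mat n n. \<Phi> X \<in> carrier_mat n n) \<and>
     (\<forall>X \<in> carrier_mat n n. \<forall>Y \<in> carrier_mat n n. \<Phi> (X + Y) = \<Phi> X + \<Phi> Y) \<and>
     (\<forall>c. \<forall>X \<in> carrier_mat n n. \<Phi> (c \<cdot>\<^sub>m X) = c \<cdot>\<^sub>m \<Phi> X)"

text \<open>
  The map \<open>\<Phi> \<otimes> id\<close> on operators on \<open>\<complex>\<^sup>n \<otimes> \<complex>\<^sup>k\<close>: writing \<open>X = \<Sum> X\<^sub>a\<^sub>b \<otimes> |a\<rangle>\<langle>b|\<close>, where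
  \<open>X\<^sub>a\<^sub>b\<close> is \<open>block_op n k X a b\<close>, it sends \<open>X\<close> to \<open>\<Sum> \<Phi> X\<^sub>a\<^sub>b \<otimes> |a\<rangle>\<langle>b|\<close>.
\<close>

definition block_op :: "nat \<Rightarrow> nat \<Rightarrow> complex mat \<Rightarrow> nat \<Rightarrow> nat \<Rightarrow> complex mat" where
  "block_op n k X a b = mat n n (\<lambda>(i, j). X $$ (i * k + a, j * k + b))"

definition tensor_id_map ::
    "nat \<Rightarrow> nat \<Rightarrow> (complex mat \<Rightarrow> complex mat) \<Rightarrow> complex mat \<Rightarrow> complex mat" where
  "tensor_id_map n k \<Phi> X = mat (n * k) (n * k)
     (\<lambda>(r, c). \<Phi> (block_op n k X (r mod k) (c mod k)) $$ (r div k, c div k))"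

definition completely_positive :: "nat \<Rightarrow> (complex mat \<Rightarrow> complex mat) \<Rightarrow> bool" where
  "completely_positive n \<Phi> \<longleftrightarrow>
     (\<forall>k X. positive_op (n * k) X \<longrightarrow> positive_op (n * k) (tensor_id_map n k \<Phi> X))"

definition trace_preserving :: "nat \<Rightarrow> (complex mat \<Rightarrow> complex mat) \<Rightarrow> bool" where
  "trace_preserving n \<Phi> \<longleftrightarrow> (\<forall>X \<in> carrier_mat n n. trace_op (\<Phi> X) = trace_op X)"

definition quantum_map :: "nat \<Rightarrow> (complex mat \<Rightarrow> complex mat) \<Rightarrow> bool" where
  "quantum_map n \<Phi> \<longleftrightarrow>
     linear_map_op n \<Phi> \<and> completely_positive n \<Phi> \<and> trace_preserving n \<Phi>"

definition unital_map :: "nat \<Rightarrow> (complex mat \<Rightarrow> complex mat) \<Rightarrow> bool" where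
  "unital_map n \<Phi> \<longleftrightarrow> \<Phi> (maximally_mixed n) = maximally_mixed n"

definition catalytic_map :: "nat \<Rightarrow> (complex mat \<Rightarrow> complex mat) \<Rightarrow> bool" where
  "catalytic_map n \<Phi> \<longleftrightarrow>
     (\<exists>m \<sigma> U V. quantum_state m \<sigma> \<and> unitary_op (n * m) U \<and> unitary_op m V \<and>
        (\<forall>\<rho>. quantum_state n \<rho> \<longrightarrow>
           ptrace_snd n m (U * tensor_op \<rho> \<sigma> * mat_adjoint U) = \<Phi> \<rho> \<and>
           ptrace_fst n m (U * tensor_op \<rho> \<sigma> * mat_adjoint U) = V * \<sigma> * mat_adjoint V))"

lemma tensor_index_less:
  fixes i n a m :: nat
  assumes "i < n" "a < m"
  shows "i * m + a < n * m"
proof -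
  have "i * m + a < Suc i * m" using assms by simp
  also have "\<dots> \<le> n * m" using assms by (intro mult_right_mono) auto
  finally show ?thesis .
qed

lemma index_tensor_op:
  assumes "X \<in> carrier_mat n n" "Y \<in> carrier_mat m m" "i < n" "j < n" "a < m" "b < m"
  shows "tensor_op X Y $$ (i * m + a, j * m + b) = X $$ (i, j) * Y $$ (a, b)"
  using assms tensor_index_less[of i n a m] tensor_index_less[of j n b m]
  by (auto simp: tensor_op_def)

lemma ptrace_snd_tensor_op:
  assumes "X \<in> carrier_mat n n" "Y \<in> carrier_mat m m"
  shows "ptrace_snd n m (tensor_op X Y) = trace_op Y \<cdot>\<^sub>m X"
  using assms
  by (intro eq_matI)
    (auto simp: ptrace_snd_def trace_op_def index_tensor_op sum_distrib_left mult.commute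
       intro!: sum.cong)

lemma ptrace_fst_tensor_op:
  assumes "X \<in> carrier_mat n n" "Y \<in> carrier_mat m m"
  shows "ptrace_fst n m (tensor_op X Y) = trace_op X \<cdot>\<^sub>m Y"
  using assms
  by (intro eq_matI)
    (auto simp: ptrace_fst_def trace_op_def index_tensor_op sum_distrib_right intro!: sum.cong)

lemma tensor_id_map_tensor_op:
  assumes "linear_map_op n \<Phi>" "X \<in> carrier_mat n n" "Y \<in> carrier_mat k k"
  shows "tensor_id_map n k \<Phi> (tensor_op X Y) = tensor_op (\<Phi> X) Y"
proof -
  have block: "block_op n k (tensor_op X Y) a b = Y $$ (a, b) \<cdot>\<^sub>m X" if "a < k" "b < k" for a b
    using assms that by (intro eq_matI) (auto simp: block_op_def index_tensor_op)
  have PX: "\<Phi> X \<in> carrier_mat n n" using assms by (auto simp: linear_map_op_def)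
  show ?thesis
  proof (rule eq_matI)
    fix r c assume "r < dim_row (tensor_op (\<Phi> X) Y)" "c < dim_col (tensor_op (\<Phi> X) Y)"
    then have rc: "r < n * k" "c < n * k" using PX assms by (auto simp: tensor_op_def)
    then have "k > 0" by (cases k) auto
    then show "tensor_id_map n k \<Phi> (tensor_op X Y) $$ (r, c) = tensor_op (\<Phi> X) Y $$ (r, c)"
      using rc assms PX
      by (auto simp: tensor_id_map_def block linear_map_op_def tensor_op_def[of "\<Phi> X"]
          less_mult_imp_div_less)
  qed (use PX assms in \<open>auto simp: tensor_id_map_def tensor_op_def\<close>)
qed

end

theory Submission
  imports Defs
begin

text \<open>
  The counterexample is the Werner--Holevo channel \<open>\<Phi> X = (tr X \<cdot> 1 - X\<^sup>T) / 2\<close> on \<open>\<complex>\<^sup>3\<close>, whose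
  Kraus operators are the three antisymmetric matrices \<open>(|p\<rangle>\<langle>i| - |i\<rangle>\<langle>p|) / \<surd>2\<close>. Write \<open>U\<^sub>i\<^sub>k\<close> for
  the operators on the catalyst system that form the blocks of \<open>U\<close>. The condition on the output
  of the channel makes the seminorm \<open>tr (Y \<sigma> Y\<^sup>*)\<close> vanish at \<open>Y = U\<^sub>i\<^sub>k + U\<^sub>k\<^sub>i\<close>, so that
  \<open>U\<^sub>i\<^sub>k \<sigma> = - U\<^sub>k\<^sub>i \<sigma>\<close>: only three blocks \<open>u\<^sub>c\<close> matter. Unitarity of \<open>U\<close>, sandwiched between two
  copies of \<open>\<sigma>\<close>, then says \<open>\<sigma> u\<^sub>c\<^sup>* u\<^sub>d \<sigma> = \<delta>\<^sub>c\<^sub>d \<sigma>\<^sup>2 / 2\<close>. For a basis state as input, the output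
  \<open>V \<sigma> V\<^sup>*\<close> on the catalyst is a sum of two operators \<open>u\<^sub>c \<sigma> u\<^sub>c\<^sup>*\<close>; they are orthogonal, so the
  trace of its square is \<open>tr \<sigma>\<^sup>2 / 2\<close>. It is also \<open>tr \<sigma>\<^sup>2\<close>, hence \<open>\<sigma> = 0\<close>, contradicting \<open>tr \<sigma> = 1\<close>.
\<close>

section \<open>Matrix preliminaries\<close>

lemma index_mult_sum:
  assumes "A \<in> carrier_mat n p" "B \<in> carrier_mat p q" "i < n" "j < q"
  shows "(A * B) $$ (i, j) = (\<Sum>k<p. A $$ (i, k) * B $$ (k, j))"
  using assms by (auto simp: scalar_prod_def atLeast0LessThan)

lemma dim_mat_adjoint [simp]:
  "dim_row (mat_adjoint A) = dim_col A" "dim_col (mat_adjoint A) = dim_row A"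
  unfolding mat_adjoint_def by (auto simp: mat_of_rows_def)

lemma carrier_mat_adjoint:
  assumes "A \<in> carrier_mat n p"
  shows "mat_adjoint A \<in> carrier_mat p n"
  using assms by (intro carrier_matI) auto

lemma index_mat_adjoint:
  fixes A :: "complex mat"
  assumes "A \<in> carrier_mat n p" "i < p" "j < n"
  shows "mat_adjoint A $$ (i, j) = cnj (A $$ (j, i))"
  using assms unfolding mat_adjoint_def by (auto simp: mat_of_rows_def)

lemma mat_adjoint_mult:
  fixes A B :: "complex mat"
  assumes "A \<in> carrier_mat n p" "B \<in> carrier_mat p q"
  shows "mat_adjoint (A * B) = mat_adjoint B * mat_adjoint A"
proof (rule eq_matI)
  fix i j assume "i < dim_row (mat_adjoint B * mat_adjoint A)" "j < dim_col (mat_adjoint B * mat_adjoint A)"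
  then have ij: "i < q" "j < n" using assms carrier_mat_adjoint[OF assms(1)] carrier_mat_adjoint[OF assms(2)] by auto
  have "mat_adjoint (A * B) $$ (i, j) = cnj (\<Sum>k<p. A $$ (j, k) * B $$ (k, i))"
    using assms ij by (simp add: index_mat_adjoint[of _ n q] index_mult_sum[OF assms] del: index_mult_mat)
  also have "\<dots> = (mat_adjoint B * mat_adjoint A) $$ (i, j)"
    using assms ij
    by (simp add: index_mult_sum[OF carrier_mat_adjoint[OF assms(2)] carrier_mat_adjoint[OF assms(1)]]
        index_mat_adjoint[OF assms(1)] index_mat_adjoint[OF assms(2)] mult.commute del: index_mult_mat)
  finally show "mat_adjoint (A * B) $$ (i, j) = (mat_adjoint B * mat_adjoint A) $$ (i, j)" .
qed (use carrier_mat_adjoint[OF assms(1)] carrier_mat_adjoint[OF assms(2)]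
       carrier_mat_adjoint[of "A * B" n q] assms in auto)

lemma mat_adjoint_adjoint:
  fixes A :: "complex mat"
  assumes A: "A \<in> carrier_mat n p"
  shows "mat_adjoint (mat_adjoint A) = A"
proof (rule eq_matI)
  note B = carrier_mat_adjoint[OF A]
  note C = carrier_mat_adjoint[OF B]
  show "dim_row (mat_adjoint (mat_adjoint A)) = dim_row A"
    "dim_col (mat_adjoint (mat_adjoint A)) = dim_col A" using C A by auto
  fix i j assume "i < dim_row A" "j < dim_col A"
  then show "mat_adjoint (mat_adjoint A) $$ (i, j) = A $$ (i, j)"
    using A by (simp add: index_mat_adjoint[OF B] index_mat_adjoint[OF A])
qed

lemma eq_uminus_if_add_eq_0_mat:
  fixes A B :: "'a::group_add mat"
  assumes A: "A \<in> carrier_mat n p" and B: "B \<in> carrier_mat n p" and AB: "A + B = 0\<^sub>m n p"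
  shows "A = - B"
proof (rule eq_matI)
  fix i j assume "i < dim_row (- B)" "j < dim_col (- B)"
  then have ij: "i < n" "j < p" using B by auto
  have "(A + B) $$ (i, j) = 0" using ij by (simp add: AB)
  then show "A $$ (i, j) = (- B) $$ (i, j)" using ij A B by (simp add: eq_neg_iff_add_eq_0)
qed (use A B in auto)

lemma trace_op_carrier: "A \<in> carrier_mat n n \<Longrightarrow> trace_op A = (\<Sum>i<n. A $$ (i, i))"
  by (auto simp: trace_op_def)

lemma trace_op_add:
  "A \<in> carrier_mat n n \<Longrightarrow> B \<in> carrier_mat n n \<Longrightarrow> trace_op (A + B) = trace_op A + trace_op B"
  by (simp add: trace_op_carrier[of _ n] sum.distrib)

lemma trace_op_smult: "A \<in> carrier_mat n n \<Longrightarrow> trace_op (c \<cdot>\<^sub>m A) = c * trace_op A"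
  by (simp add: trace_op_carrier[of _ n] sum_distrib_left)

lemma trace_op_mult_comm:
  assumes "A \<in> carrier_mat n p" "B \<in> carrier_mat p n"
  shows "trace_op (A * B) = trace_op (B * A)"
proof -
  have "trace_op (A * B) = (\<Sum>i<n. \<Sum>k<p. A $$ (i, k) * B $$ (k, i))"
    using assms by (simp add: trace_op_carrier[of _ n] index_mult_sum[OF assms] del: index_mult_mat)
  also have "\<dots> = (\<Sum>k<p. \<Sum>i<n. A $$ (i, k) * B $$ (k, i))" by (rule sum.swap)
  also have "\<dots> = trace_op (B * A)"
    using assms by (simp add: trace_op_carrier[of _ p] index_mult_sum[OF assms(2,1)] mult.commute del: index_mult_mat)
  finally show ?thesis .
qed

lemma sum_tensor_index:
  fixes f :: "nat \<Rightarrow> 'a::comm_monoid_add"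
  shows "(\<Sum>r<n * m. f r) = (\<Sum>i<n. \<Sum>a<m. f (i * m + a))"
proof -
  have "(\<Sum>r<n * m. f r) = (\<Sum>i<n. sum f {i * m..<i * m + m})" by (rule sum.nat_group[symmetric])
  also have "\<dots> = (\<Sum>i<n. \<Sum>a<m. f (i * m + a))"
  proof (rule sum.cong)
    fix i
    have "sum f {i * m..<i * m + m} = sum f {0 + i * m..<m + i * m}" by (simp add: add.commute)
    also have "\<dots> = (\<Sum>a<m. f (i * m + a))"
      unfolding sum.shift_bounds_nat_ivl by (simp add: atLeast0LessThan add.commute)
    finally show "sum f {i * m..<i * m + m} = (\<Sum>a<m. f (i * m + a))" .
  qed simp
  finally show ?thesis .
qed

section \<open>Positive operators\<close>

text \<open>The sesquilinear form of \<open>X\<close>, antilinear in the first slot. Its arguments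
  are plain functions, so vectors can be combined without carrier conditions; only their values
  below \<open>n\<close> count.\<close>

definition sesq :: "nat \<Rightarrow> complex mat \<Rightarrow> (nat \<Rightarrow> complex) \<Rightarrow> (nat \<Rightarrow> complex) \<Rightarrow> complex" where
  "sesq n X f g = (\<Sum>r<n. \<Sum>s<n. cnj (f r) * X $$ (r, s) * g s)"

lemma quadratic_form_sesq:
  assumes "X \<in> carrier_mat n n" "v \<in> carrier_vec n"
  shows "(X *\<^sub>v v) \<bullet>c v = sesq n X (\<lambda>i. v $ i) (\<lambda>i. v $ i)"
  using assms
  by (auto simp: sesq_def scalar_prod_def mult_mat_vec_def atLeast0LessThan sum_distrib_left
      sum_distrib_right algebra_simps intro!: sum.cong)

lemma sesq_cong:
  assumes "\<And>i. i < n \<Longrightarrow> f i = f' i" "\<And>i. i < n \<Longrightarrow> g i = g' i"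
  shows "sesq n X f g = sesq n X f' g'"
  unfolding sesq_def using assms by (intro sum.cong) auto

lemma positive_op_iff_sesq:
  "positive_op n X \<longleftrightarrow> X \<in> carrier_mat n n \<and> (\<forall>f. 0 \<le> sesq n X f f)"
proof
  assume L: "positive_op n X"
  then have X: "X \<in> carrier_mat n n" by (simp add: positive_op_def)
  have "0 \<le> sesq n X f f" for f
  proof -
    have "0 \<le> (X *\<^sub>v vec n f) \<bullet>c vec n f" using L by (simp add: positive_op_def)
    then show ?thesis
      using sesq_cong[of n "\<lambda>i. vec n f $ i" f "\<lambda>i. vec n f $ i" f X]
      by (simp add: quadratic_form_sesq[OF X])
  qed
  with X show "X \<in> carrier_mat n n \<and> (\<forall>f. 0 \<le> sesq n X f f)" by blast
qed (auto simp: positive_op_def quadratic_form_sesq)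

lemma sesq_add_right: "sesq n X f (\<lambda>i. g i + h i) = sesq n X f g + sesq n X f h"
  by (simp add: sesq_def algebra_simps sum.distrib)

lemma sesq_add_left: "sesq n X (\<lambda>i. g i + h i) f = sesq n X g f + sesq n X h f"
  by (simp add: sesq_def algebra_simps sum.distrib)

lemma sesq_scale_right: "sesq n X f (\<lambda>i. c * g i) = c * sesq n X f g"
  by (simp add: sesq_def algebra_simps sum_distrib_left)

lemma sesq_scale_left: "sesq n X (\<lambda>i. c * g i) f = cnj c * sesq n X g f"
  by (simp add: sesq_def algebra_simps sum_distrib_left)

lemma sesq_basis_left:
  assumes "r < n"
  shows "sesq n X (\<lambda>i. if i = r then 1 else 0) g = (\<Sum>s<n. X $$ (r, s) * g s)"
proof -
  have "sesq n X (\<lambda>i. if i = r then 1 else 0) g = (\<Sum>i<n. if i = r then \<Sum>s<n. X $$ (i, s) * g s else 0)"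
    unfolding sesq_def by (intro sum.cong) auto
  then show ?thesis using assms by simp
qed

lemma sesq_basis:
  assumes "r < n" "s < n"
  shows "sesq n X (\<lambda>i. if i = r then 1 else 0) (\<lambda>i. if i = s then 1 else 0) = X $$ (r, s)"
proof -
  have "(\<Sum>t<n. X $$ (r, t) * (if t = s then 1 else 0)) = (\<Sum>t<n. if t = s then X $$ (r, t) else 0)"
    by (intro sum.cong) auto
  then show ?thesis using assms by (simp add: sesq_basis_left)
qed

text \<open>Polarization: the form is real at \<open>f\<close>, \<open>g\<close>,
  \<open>f + g\<close> and \<open>f + \<i> g\<close>. The third vector compares the imaginary parts
  of the two mixed terms, the fourth their real parts.\<close>

lemma sesq_conj_sym:
  assumes "positive_op n X"
  shows "sesq n X g f = cnj (sesq n X f g)"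
proof -
  have pos: "0 \<le> sesq n X h h" for h using assms by (simp add: positive_op_iff_sesq)
  have "Im (sesq n X h h) = 0" for h using pos[of h] by (simp add: less_eq_complex_def)
  from this[of "\<lambda>i. f i + g i"] this[of "\<lambda>i. f i + \<i> * g i"] this[of f] this[of g]
  show ?thesis
    by (simp add: sesq_add_left sesq_add_right sesq_scale_left sesq_scale_right complex_eq_iff)
qed

lemma positive_op_hermitian:
  assumes "positive_op n X"
  shows "mat_adjoint X = X"
proof -
  have X: "X \<in> carrier_mat n n" using assms by (simp add: positive_op_def)
  note B = carrier_mat_adjoint[OF X]
  show ?thesis
  proof (rule eq_matI)
    fix i j assume "i < dim_row X" "j < dim_col X"
    then have ij: "i < n" "j < n" using X by auto
    then show "mat_adjoint X $$ (i, j) = X $$ (i, j)"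
      using sesq_conj_sym[OF assms, of "\<lambda>k. if k = i then 1 else 0" "\<lambda>k. if k = j then 1 else 0"]
      by (simp add: index_mat_adjoint[OF X] sesq_basis)
  qed (use X B in auto)
qed

text \<open>The degenerate case of Cauchy-Schwarz: if the mixed term \<open>b\<close> were nonzero,
  a small step from \<open>f\<close> in the direction of \<open>g\<close> would make the form
  negative.\<close>

lemma sesq_null:
  assumes pos: "positive_op n X" and null: "sesq n X f f = 0"
  shows "sesq n X g f = 0"
proof -
  define b where "b = sesq n X g f"
  define \<beta> where "\<beta> = Re (sesq n X g g)"
  have \<beta>: "\<beta> \<ge> 0" using pos by (simp add: positive_op_iff_sesq \<beta>_def less_eq_complex_def)
  \<comment> \<open>With \<open>z = - s b\<close> the form at \<open>f + z g\<close> equals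
    \<open>s (s \<beta> - 2)\<close> times the squared modulus of \<open>b\<close>. The optimal
    \<open>s\<close> would be \<open>1 / \<beta>\<close>; adding 1 to the denominator allows
    \<open>\<beta> = 0\<close> and still gives \<open>s \<beta> < 2\<close>.\<close>
  define s where "s = 1 / (1 + \<beta>)"
  define z where "z = - of_real s * b"
  have fg: "sesq n X f g = cnj b" unfolding b_def by (rule sesq_conj_sym[OF pos])
  have "0 \<le> Re (sesq n X (\<lambda>i. f i + z * g i) (\<lambda>i. f i + z * g i))"
    using pos by (simp add: positive_op_iff_sesq less_eq_complex_def)
  also have "sesq n X (\<lambda>i. f i + z * g i) (\<lambda>i. f i + z * g i)
      = z * cnj b + cnj z * b + (z * cnj z) * sesq n X g g"
    by (simp add: sesq_add_left sesq_add_right sesq_scale_left sesq_scale_right null fg algebra_simps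
        flip: b_def)
  also have "z * cnj b = of_real (- s * (cmod b)\<^sup>2)"
    by (simp add: z_def complex_norm_square[symmetric] mult.assoc)
  also have "cnj z * b = of_real (- s * (cmod b)\<^sup>2)"
    by (simp add: z_def complex_norm_square[symmetric] mult.assoc mult.commute[of "cnj b"])
  also have "z * cnj z = of_real (s\<^sup>2 * (cmod b)\<^sup>2)"
    unfolding complex_norm_square[symmetric]
    by (simp add: z_def norm_mult power_mult_distrib)
  finally have "0 \<le> (cmod b)\<^sup>2 * (s * (s * \<beta> - 2))"
    by (simp add: \<beta>_def algebra_simps power2_eq_square)
  moreover have "s * (s * \<beta> - 2) < 0"
    using \<beta> by (intro mult_pos_neg) (auto simp: s_def field_simps)
  ultimately have "\<not> 0 < (cmod b)\<^sup>2" using mult_pos_neg not_le by blast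
  then show ?thesis by (simp add: b_def)
qed

text \<open>The trace is a sum, over the rows of \<open>Y\<close>, of the form of
  \<open>\<sigma>\<close> at the conjugated row. The summands are nonnegative, so all vanish, and
  \<open>sesq_null\<close> then kills the pairing of each row with every basis vector; these
  pairings are, up to conjugation, the entries of \<open>Y * \<sigma>\<close>.\<close>

lemma mult_eq_0_if_trace_eq_0:
  assumes pos: "positive_op m \<sigma>" and Y: "Y \<in> carrier_mat m m"
    and tr: "trace_op (Y * \<sigma> * mat_adjoint Y) = 0"
  shows "Y * \<sigma> = 0\<^sub>m m m"
proof -
  have S: "\<sigma> \<in> carrier_mat m m" using pos by (simp add: positive_op_def)
  note YA = carrier_mat_adjoint[OF Y]
  define f where "f a = (\<lambda>b. cnj (Y $$ (a, b)))" for a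
  have diag: "(Y * \<sigma> * mat_adjoint Y) $$ (a, a) = sesq m \<sigma> (f a) (f a)" if a: "a < m" for a
  proof -
    have "(Y * \<sigma> * mat_adjoint Y) $$ (a, a)
        = (\<Sum>s<m. (\<Sum>r<m. Y $$ (a, r) * \<sigma> $$ (r, s)) * cnj (Y $$ (a, s)))"
      using S a
      by (simp add: index_mult_sum[OF mult_carrier_mat[OF Y S] YA] index_mult_sum[OF Y S]
          index_mat_adjoint[OF Y] del: index_mult_mat)
    also have "\<dots> = (\<Sum>s<m. \<Sum>r<m. Y $$ (a, r) * \<sigma> $$ (r, s) * cnj (Y $$ (a, s)))"
      by (simp add: sum_distrib_right)
    also have "\<dots> = (\<Sum>r<m. \<Sum>s<m. Y $$ (a, r) * \<sigma> $$ (r, s) * cnj (Y $$ (a, s)))" by (rule sum.swap)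
    finally show ?thesis by (simp add: sesq_def f_def)
  qed
  have nonneg: "0 \<le> sesq m \<sigma> (f a) (f a)" for a using pos by (simp add: positive_op_iff_sesq)
  have "(\<Sum>a<m. sesq m \<sigma> (f a) (f a)) = 0"
    using tr diag mult_carrier_mat[OF mult_carrier_mat[OF Y S] YA]
    by (simp add: trace_op_carrier[of _ m] del: index_mult_mat)
  then have null: "sesq m \<sigma> (f a) (f a) = 0" if "a < m" for a
    using that nonneg by (subst (asm) sum_nonneg_eq_0_iff) auto
  show ?thesis
  proof (rule eq_matI)
    fix a b assume "a < dim_row (0\<^sub>m m m :: complex mat)" "b < dim_col (0\<^sub>m m m :: complex mat)"
    then have ab: "a < m" "b < m" by auto
    have "0 = cnj (\<Sum>s<m. \<sigma> $$ (b, s) * f a s)"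
      using sesq_null[OF pos null[OF ab(1)], of "\<lambda>i. if i = b then 1 else 0"] ab
      by (simp add: sesq_basis_left)
    also have "\<dots> = (\<Sum>s<m. Y $$ (a, s) * mat_adjoint \<sigma> $$ (s, b))"
      using ab by (simp add: f_def index_mat_adjoint[OF S] mult.commute)
    also have "\<dots> = (Y * \<sigma>) $$ (a, b)"
      using ab by (simp add: positive_op_hermitian[OF pos] index_mult_sum[OF Y S] del: index_mult_mat)
    finally show "(Y * \<sigma>) $$ (a, b) = 0\<^sub>m m m $$ (a, b)" using ab by simp
  qed (use Y S in auto)
qed

section \<open>The Werner--Holevo channel\<close>

text \<open>For \<open>n = 1\<close> the division by zero makes this the zero map, which is
  completely positive but does not preserve the trace; hence the different lower bounds on
  \<open>n\<close> below.\<close>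

definition werner_holevo :: "nat \<Rightarrow> complex mat \<Rightarrow> complex mat" where
  "werner_holevo n X = mat n n
     (\<lambda>(i, j). ((if i = j then trace_op X else 0) - X $$ (j, i)) / (of_nat n - 1))"

lemma linear_map_op_werner_holevo: "linear_map_op n (werner_holevo n)"
  unfolding linear_map_op_def
proof (intro conjI ballI allI)
  fix X Y :: "complex mat" and c assume X: "X \<in> carrier_mat n n" and Y: "Y \<in> carrier_mat n n"
  show "werner_holevo n X \<in> carrier_mat n n" by (simp add: werner_holevo_def)
  show "werner_holevo n (X + Y) = werner_holevo n X + werner_holevo n Y"
    using X Y by (intro eq_matI)
      (auto simp: werner_holevo_def trace_op_add[OF X Y] diff_divide_distrib add_divide_distrib)
  show "werner_holevo n (c \<cdot>\<^sub>m X) = c \<cdot>\<^sub>m werner_holevo n X"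
    using X by (intro eq_matI)
      (auto simp: werner_holevo_def trace_op_smult[OF X] right_diff_distrib diff_divide_distrib)
qed

lemma trace_preserving_werner_holevo:
  assumes "n \<ge> 2"
  shows "trace_preserving n (werner_holevo n)"
  unfolding trace_preserving_def
proof
  fix X :: "complex mat" assume X: "X \<in> carrier_mat n n"
  have n1: "of_nat n - 1 \<noteq> (0::complex)" using assms by auto
  have "trace_op (werner_holevo n X) = (\<Sum>i<n. (trace_op X - X $$ (i, i)) / (of_nat n - 1))"
    by (simp add: trace_op_def[of "werner_holevo n X"]) (simp add: werner_holevo_def)
  also have "\<dots> = (of_nat n * trace_op X - trace_op X) / (of_nat n - 1)"
    by (simp add: sum_divide_distrib[symmetric] sum_subtractf trace_op_carrier[OF X])
  also have "\<dots> = trace_op X" using n1 by (simp add: field_simps)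
  finally show "trace_op (werner_holevo n X) = trace_op X" .
qed

lemma unital_map_werner_holevo:
  assumes "n \<ge> 2"
  shows "unital_map n (werner_holevo n)"
proof -
  have n1: "of_nat n - 1 \<noteq> (0::complex)" "of_nat n \<noteq> (0::complex)" using assms by auto
  have tr: "trace_op (maximally_mixed n) = 1"
    using assms by (simp add: trace_op_def maximally_mixed_def)
  show ?thesis
    unfolding unital_map_def
  proof (rule eq_matI)
    fix i j assume "i < dim_row (maximally_mixed n)" "j < dim_col (maximally_mixed n)"
    then have ij: "i < n" "j < n" by (auto simp: maximally_mixed_def)
    have "(1 - 1 / of_nat n) / (of_nat n - 1) = (1 / of_nat n :: complex)"
      using n1 by (simp add: field_simps)
    then show "werner_holevo n (maximally_mixed n) $$ (i, j) = maximally_mixed n $$ (i, j)"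
      using ij by (auto simp: werner_holevo_def tr) (auto simp: maximally_mixed_def)
  qed (auto simp: werner_holevo_def maximally_mixed_def)
qed

lemma sesq_tensor_index:
  "sesq (n * k) X f g = (\<Sum>i<n. \<Sum>j<n. \<Sum>a<k. \<Sum>b<k.
     cnj (f (i * k + a)) * X $$ (i * k + a, j * k + b) * g (j * k + b))"
  unfolding sesq_def sum_tensor_index by (intro sum.cong refl sum.swap)

text \<open>A Kraus decomposition at the level of quadratic forms: the form of the output at
  \<open>f\<close> is a nonnegative multiple of a sum of forms of \<open>X\<close> at vectors
  \<open>w i p\<close> built from \<open>f\<close>.\<close>

lemma completely_positive_werner_holevo:
  assumes "n \<ge> 1"
  shows "completely_positive n (werner_holevo n)"
  unfolding completely_positive_def
proof (intro allI impI)
  fix k X assume pos: "positive_op (n * k) X"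
  define T where "T = tensor_id_map n k (werner_holevo n) X"
  have T: "T \<in> carrier_mat (n * k) (n * k)" by (simp add: T_def tensor_id_map_def)
  have entry: "T $$ (i * k + a, j * k + b) =
      ((if i = j then \<Sum>p<n. X $$ (p * k + a, p * k + b) else 0) - X $$ (j * k + a, i * k + b))
        / (of_nat n - 1)"
    if "i < n" "j < n" "a < k" "b < k" for i j a b
    using that tensor_index_less[of i n a k] tensor_index_less[of j n b k]
    by (simp add: T_def tensor_id_map_def werner_holevo_def block_op_def trace_op_def)
  have "0 \<le> sesq (n * k) T f f" for f
  proof -
    \<comment> \<open>Slices \<open>i\<close> and \<open>j\<close> of \<open>f\<close> are paired
      through block \<open>(p, q)\<close> of \<open>X\<close>. Keeping slice and block labels
      independent lets the trace part (\<open>D i i p p\<close>) and the transpose part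
      (\<open>D i j j i\<close>) be instances of one expression.\<close>
    define D where "D i j p q = (\<Sum>a<k. \<Sum>b<k. cnj (f (i * k + a)) * X $$ (p * k + a, q * k + b) *
      f (j * k + b))" for i j p q
    \<comment> \<open>Slice \<open>i\<close> of \<open>f\<close> moved to position \<open>p\<close>:
      the operator \<open>|p><i|\<close>, tensored with the identity, applied to
      \<open>f\<close>.\<close>
    define h where "h i p = (\<lambda>r. if r div k = p then f (i * k + r mod k) else 0)" for i p
    have hD: "sesq (n * k) X (h i p) (h j q) = D i j p q" if "p < n" "q < n" for i j p q
    proof -
      have "sesq (n * k) X (h i p) (h j q)
          = (\<Sum>r<n. \<Sum>s<n. if r = p \<and> s = q then D i j r s else 0)"
        unfolding sesq_tensor_index
      proof (intro sum.cong refl)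
        fix r s
        show "(\<Sum>a<k. \<Sum>b<k. cnj (h i p (r * k + a)) * X $$ (r * k + a, s * k + b) * h j q (s * k + b))
            = (if r = p \<and> s = q then D i j r s else 0)"
          by (cases "r = p \<and> s = q") (auto simp: h_def D_def intro!: sum.cong sum.neutral)
      qed
      also have "\<dots> = (\<Sum>r<n. if r = p then \<Sum>s<n. if s = q then D i j r s else 0 else 0)"
        by (intro sum.cong refl) auto
      finally have "sesq (n * k) X (h i p) (h j q)
          = (\<Sum>r<n. if r = p then \<Sum>s<n. if s = q then D i j r s else 0 else 0)" .
      then show ?thesis using that by simp
    qed
    \<comment> \<open>Up to the factor \<open>n - 1\<close>, the map is half the sum over \<open>i, p\<close> of the conjugations with
      \<open>|p\<rangle>\<langle>i| - |i\<rangle>\<langle>p|\<close>.\<close>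
    define w where "w i p = (\<lambda>r. h i p r + (-1) * h p i r)" for i p
    have ww: "sesq (n * k) X (w i p) (w i p) = D i i p p - D i p p i - D p i i p + D p p i i"
      if "i < n" "p < n" for i p
      unfolding w_def sesq_add_left sesq_add_right sesq_scale_left sesq_scale_right
      using that by (simp add: hD)
    have "sesq (n * k) T f f
        = (\<Sum>i<n. \<Sum>j<n. ((if i = j then \<Sum>p<n. D i j p p else 0) - D i j j i) / (of_nat n - 1))"
      unfolding sesq_tensor_index
    proof (intro sum.cong refl)
      fix i j assume "i \<in> {..<n}" "j \<in> {..<n}"
      then have ij: "i < n" "j < n" by auto
      have sw: "(\<Sum>p<n. D i j p p) = (\<Sum>a<k. \<Sum>b<k. cnj (f (i * k + a)) *
          (\<Sum>p<n. X $$ (p * k + a, p * k + b)) * f (j * k + b))"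
        unfolding D_def sum_distrib_left sum_distrib_right
        by (subst sum.swap, intro sum.cong refl sum.swap)
      have "(\<Sum>a<k. \<Sum>b<k. cnj (f (i * k + a)) * T $$ (i * k + a, j * k + b) * f (j * k + b))
          = (\<Sum>a<k. \<Sum>b<k. (cnj (f (i * k + a)) *
               (if i = j then \<Sum>p<n. X $$ (p * k + a, p * k + b) else 0) * f (j * k + b)
             - cnj (f (i * k + a)) * X $$ (j * k + a, i * k + b) * f (j * k + b)) / (of_nat n - 1))"
        using ij by (intro sum.cong refl) (simp add: entry left_diff_distrib right_diff_distrib)
      also have "\<dots> = ((if i = j then \<Sum>p<n. D i j p p else 0) - D i j j i) / (of_nat n - 1)"
        unfolding sw by (simp add: D_def[of i j j i] sum_divide_distrib[symmetric] sum_subtractf)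
      finally show "(\<Sum>a<k. \<Sum>b<k. cnj (f (i * k + a)) * T $$ (i * k + a, j * k + b) * f (j * k + b))
          = ((if i = j then \<Sum>p<n. D i j p p else 0) - D i j j i) / (of_nat n - 1)" .
    qed
    also have "\<dots> = ((\<Sum>i<n. \<Sum>p<n. D i i p p) - (\<Sum>i<n. \<Sum>j<n. D i j j i)) / (of_nat n - 1)"
      by (simp add: sum_divide_distrib[symmetric] sum_subtractf)
    also have "\<dots> = of_real (1 / (2 * (real n - 1))) *
        (\<Sum>i<n. \<Sum>p<n. sesq (n * k) X (w i p) (w i p))"
    proof -
      have "(\<Sum>i<n. \<Sum>p<n. sesq (n * k) X (w i p) (w i p))
          = (\<Sum>i<n. \<Sum>p<n. D i i p p - D i p p i - D p i i p + D p p i i)"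
        by (intro sum.cong refl) (simp add: ww)
      \<comment> \<open>Exchanging the names \<open>i\<close> and \<open>p\<close> identifies the
        two positive terms with each other, and likewise the two negative ones.\<close>
      also have "\<dots> = 2 * ((\<Sum>i<n. \<Sum>p<n. D i i p p) - (\<Sum>i<n. \<Sum>j<n. D i j j i))"
        using sum.swap[of "\<lambda>i p. D p i i p" "{..<n}" "{..<n}"]
          sum.swap[of "\<lambda>i p. D p p i i" "{..<n}" "{..<n}"]
        by (simp add: sum.distrib sum_subtractf algebra_simps)
      finally have eq: "(\<Sum>i<n. \<Sum>p<n. sesq (n * k) X (w i p) (w i p))
          = 2 * ((\<Sum>i<n. \<Sum>p<n. D i i p p) - (\<Sum>i<n. \<Sum>j<n. D i j j i))" .
      have half: "x / y = 1 / (2 * y) * (2 * x)" for x y :: complex by simp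
      have "of_real (1 / (2 * (real n - 1))) = 1 / (2 * (of_nat n - 1 :: complex))" by simp
      then show ?thesis unfolding eq by (simp only: half[symmetric])
    qed
    also have "0 \<le> \<dots>"
    proof -
      have "0 \<le> (\<Sum>i<n. \<Sum>p<n. sesq (n * k) X (w i p) (w i p))"
        using pos by (intro sum_nonneg) (auto simp: positive_op_iff_sesq)
      moreover have "0 \<le> 1 / (2 * (real n - 1))" using assms by simp
      ultimately show ?thesis
        unfolding less_eq_complex_def by (simp del: of_real_divide of_real_mult)
    qed
    finally show ?thesis .
  qed
  with T show "positive_op (n * k) (tensor_id_map n k (werner_holevo n) X)"
    unfolding positive_op_iff_sesq T_def by blast
qed

lemma quantum_map_werner_holevo: "n \<ge> 2 \<Longrightarrow> quantum_map n (werner_holevo n)"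
  by (simp add: quantum_map_def linear_map_op_werner_holevo trace_preserving_werner_holevo
      completely_positive_werner_holevo)

section \<open>Block decomposition of operators on a tensor product\<close>

text \<open>The block \<open>U\<^sub>i\<^sub>k\<close>, an operator on the catalyst. Here the
  indices of the first tensor factor are fixed, whereas \<open>block_op\<close> fixes those of the
  second.\<close>

definition sub_block :: "nat \<Rightarrow> complex mat \<Rightarrow> nat \<Rightarrow> nat \<Rightarrow> complex mat" where
  "sub_block m U i k = mat m m (\<lambda>(a, b). U $$ (i * m + a, k * m + b))"

lemma sub_block_carrier [simp]: "sub_block m U i k \<in> carrier_mat m m"
  by (simp add: sub_block_def)

lemma tensor_op_carrier:
  "X \<in> carrier_mat n n \<Longrightarrow> Y \<in> carrier_mat m m \<Longrightarrow> tensor_op X Y \<in> carrier_mat (n * m) (n * m)"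
  by (auto simp: tensor_op_def)

text \<open>Both partial traces are read off from this formula: summing over \<open>a = b\<close>
  gives the channel output, summing over \<open>i = j\<close> the catalyst output.\<close>

lemma index_conjugated_tensor_op:
  assumes U: "U \<in> carrier_mat (n * m) (n * m)" and \<rho>: "\<rho> \<in> carrier_mat n n"
    and \<sigma>: "\<sigma> \<in> carrier_mat m m" and ij: "i < n" "j < n" and ab: "a < m" "b < m"
  shows "(U * tensor_op \<rho> \<sigma> * mat_adjoint U) $$ (i * m + a, j * m + b) =
    (\<Sum>k<n. \<Sum>l<n. \<rho> $$ (k, l) * (sub_block m U i k * \<sigma> * mat_adjoint (sub_block m U j l)) $$ (a, b))"
proof -
  note T = tensor_op_carrier[OF \<rho> \<sigma>]
  note lt = tensor_index_less[OF ij(1) ab(1)] tensor_index_less[OF ij(2) ab(2)]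
  have block: "(sub_block m U i k * \<sigma> * mat_adjoint (sub_block m U j l)) $$ (a, b) =
      (\<Sum>d<m. (\<Sum>c<m. U $$ (i * m + a, k * m + c) * \<sigma> $$ (c, d)) * cnj (U $$ (j * m + b, l * m + d)))"
    for k l
    using ab
    by (simp add: index_mult_sum[OF mult_carrier_mat[OF sub_block_carrier \<sigma>] carrier_mat_adjoint[OF sub_block_carrier]]
        index_mult_sum[OF sub_block_carrier \<sigma>] index_mat_adjoint[OF sub_block_carrier] del: index_mult_mat)
      (simp add: sub_block_def)
  have "(U * tensor_op \<rho> \<sigma> * mat_adjoint U) $$ (i * m + a, j * m + b) =
      (\<Sum>l<n. \<Sum>d<m. (\<Sum>k<n. \<Sum>c<m. U $$ (i * m + a, k * m + c) * (\<rho> $$ (k, l) * \<sigma> $$ (c, d)))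
         * cnj (U $$ (j * m + b, l * m + d)))"
    using lt
    by (simp add: index_mult_sum[OF mult_carrier_mat[OF U T] carrier_mat_adjoint[OF U]]
        index_mult_sum[OF U T] index_mat_adjoint[OF U] sum_tensor_index tensor_index_less
        index_tensor_op[OF \<rho> \<sigma>] del: index_mult_mat)
  also have "\<dots> = (\<Sum>l<n. \<Sum>k<n. \<Sum>d<m. \<Sum>c<m. \<rho> $$ (k, l) *
      (U $$ (i * m + a, k * m + c) * \<sigma> $$ (c, d) * cnj (U $$ (j * m + b, l * m + d))))"
    unfolding sum_distrib_right
    by (intro sum.cong[OF refl], subst sum.swap) (simp add: mult_ac)
  also have "\<dots> = (\<Sum>k<n. \<Sum>l<n. \<Sum>d<m. \<Sum>c<m. \<rho> $$ (k, l) *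
      (U $$ (i * m + a, k * m + c) * \<sigma> $$ (c, d) * cnj (U $$ (j * m + b, l * m + d))))"
    by (rule sum.swap)
  finally show ?thesis
    by (simp add: block sum_distrib_left sum_distrib_right mult_ac)
qed

lemma unitary_op_sub_block:
  assumes U: "unitary_op (n * m) U" and kl: "k < n" "l < n" and ab: "a < m" "b < m"
  shows "(\<Sum>i<n. (mat_adjoint (sub_block m U i k) * sub_block m U i l) $$ (a, b))
    = (if k = l \<and> a = b then 1 else 0)"
proof -
  have Uc: "U \<in> carrier_mat (n * m) (n * m)" using U by (simp add: unitary_op_def)
  note lt = tensor_index_less[OF kl(1) ab(1)] tensor_index_less[OF kl(2) ab(2)]
  have "(\<Sum>i<n. (mat_adjoint (sub_block m U i k) * sub_block m U i l) $$ (a, b))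
      = (\<Sum>i<n. \<Sum>c<m. cnj (U $$ (i * m + c, k * m + a)) * U $$ (i * m + c, l * m + b))"
    using ab
    by (simp add: index_mult_sum[OF carrier_mat_adjoint[OF sub_block_carrier] sub_block_carrier]
        index_mat_adjoint[OF sub_block_carrier] del: index_mult_mat) (simp add: sub_block_def)
  also have "\<dots> = (mat_adjoint U * U) $$ (k * m + a, l * m + b)"
    using lt by (simp add: index_mult_sum[OF carrier_mat_adjoint[OF Uc] Uc] index_mat_adjoint[OF Uc]
        sum_tensor_index tensor_index_less del: index_mult_mat)
  also have "\<dots> = (if k * m + a = l * m + b then 1 else 0)"
    using U lt by (simp add: unitary_op_def)
  also have "k * m + a = l * m + b \<longleftrightarrow> k = l \<and> a = b"
    using ab by (metis add_left_imp_eq div_mult_self3 less_nat_zero_code div_less add_0_right)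
  finally show ?thesis .
qed

text \<open>The density matrix of the pure state with equal amplitudes on the basis vectors in
  \<open>S\<close>. Singletons give basis states, and pairs give access to one coherence; no other
  inputs are needed to test the dilation.\<close>

definition uniform_superposition :: "nat \<Rightarrow> nat set \<Rightarrow> complex mat" where
  "uniform_superposition n S = mat n n (\<lambda>(i, j). if i \<in> S \<and> j \<in> S then 1 / of_nat (card S) else 0)"

text \<open>The matrix has rank one: its form at \<open>f\<close> is the squared modulus of the sum
  of \<open>f\<close> over \<open>S\<close>, divided by \<open>card S\<close>.\<close>

lemma quantum_state_uniform_superposition:
  assumes S: "S \<subseteq> {..<n}" "S \<noteq> {}"
  shows "quantum_state n (uniform_superposition n S)"
proof -
  have fin: "finite S" using S finite_subset by blast
  have c: "card S > 0" using S fin by (simp add: card_gt_0_iff)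
  have inter: "{..<n} \<inter> S = S" using S by blast
  have "0 \<le> sesq n (uniform_superposition n S) f f" for f
  proof -
    have "sesq n (uniform_superposition n S) f f
        = (\<Sum>i<n. if i \<in> S then \<Sum>j<n. if j \<in> S then cnj (f i) * f j / of_nat (card S) else 0 else 0)"
      unfolding sesq_def by (intro sum.cong refl) (auto simp: uniform_superposition_def intro!: sum.cong sum.neutral)
    also have "\<dots> = cnj (\<Sum>i\<in>S. f i) * (\<Sum>j\<in>S. f j) / of_nat (card S)"
      by (simp add: sum.inter_restrict[symmetric] inter sum_product sum_divide_distrib)
    also have "\<dots> = of_real ((cmod (\<Sum>i\<in>S. f i))\<^sup>2 / card S)"
      unfolding of_real_divide complex_norm_square by (simp add: mult.commute)
    finally show ?thesis by (simp add: less_eq_complex_def)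
  qed
  moreover have "trace_op (uniform_superposition n S) = 1"
  proof -
    have "trace_op (uniform_superposition n S) = (\<Sum>i<n. if i \<in> S then 1 / of_nat (card S) else 0)"
      by (simp add: trace_op_def uniform_superposition_def)
    then show ?thesis using c by (simp add: sum.inter_restrict[symmetric] inter)
  qed
  ultimately show ?thesis
    by (simp add: quantum_state_def positive_op_iff_sesq) (simp add: uniform_superposition_def)
qed

lemma sum_uniform_superposition:
  assumes S: "S \<subseteq> {..<n}"
  shows "(\<Sum>k<n. \<Sum>l<n. uniform_superposition n S $$ (k, l) * f k l) = (\<Sum>k\<in>S. \<Sum>l\<in>S. f k l) / of_nat (card S)"
proof -
  have inter: "{..<n} \<inter> S = S" using S by blast
  have "(\<Sum>k<n. \<Sum>l<n. uniform_superposition n S $$ (k, l) * f k l)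
      = (\<Sum>k<n. if k \<in> S then \<Sum>l<n. if l \<in> S then f k l / of_nat (card S) else 0 else 0)"
    by (intro sum.cong refl) (auto simp: uniform_superposition_def intro!: sum.cong sum.neutral)
  then show ?thesis
    by (simp add: sum.inter_restrict[symmetric] inter sum_divide_distrib)
qed

section \<open>The dilation blocks of the channel\<close>

lemma quantum_state_carrier: "quantum_state n \<rho> \<Longrightarrow> \<rho> \<in> carrier_mat n n"
  by (simp add: quantum_state_def positive_op_def)

text \<open>The numbers \<open>T i k j l\<close> are the Gram matrix of the blocks under the
  seminorm given by \<open>\<sigma>\<close>. The channel output fixes enough of them to show that
  \<open>U\<^sub>i\<^sub>k + U\<^sub>k\<^sub>i\<close> has seminorm zero.\<close>

lemma sub_block_antisym:
  assumes n: "n \<ge> 2" and \<sigma>: "quantum_state m \<sigma>" and U: "U \<in> carrier_mat (n * m) (n * m)"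
    and snd: "\<And>\<rho>. quantum_state n \<rho> \<Longrightarrow>
      ptrace_snd n m (U * tensor_op \<rho> \<sigma> * mat_adjoint U) = werner_holevo n \<rho>"
    and ik: "i < n" "k < n"
  shows "sub_block m U i k * \<sigma> = - (sub_block m U k i * \<sigma>)"
proof -
  have S: "\<sigma> \<in> carrier_mat m m" using \<sigma> by (rule quantum_state_carrier)
  have pos: "positive_op m \<sigma>" using \<sigma> by (simp add: quantum_state_def)
  define M where "M i k j l = sub_block m U i k * \<sigma> * mat_adjoint (sub_block m U j l)" for i k j l
  have M: "M i k j l \<in> carrier_mat m m" for i k j l
    unfolding M_def using S by (intro mult_carrier_mat[of _ m m] carrier_mat_adjoint) auto
  define T where "T i k j l = trace_op (M i k j l)" for i k j l
  \<comment> \<open>The hypothesis on the channel speaks of states only, so matrix units cannot be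
    inserted directly; each input state yields a sum of \<open>T\<close> over a square of index
    pairs.\<close>
  have key: "(\<Sum>k\<in>A. \<Sum>l\<in>A. T i k j l) / of_nat (card A) = werner_holevo n (uniform_superposition n A) $$ (i, j)"
    if A: "A \<subseteq> {..<n}" "A \<noteq> {}" and ij: "i < n" "j < n" for A i j
  proof -
    have st: "quantum_state n (uniform_superposition n A)" using A by (rule quantum_state_uniform_superposition)
    have "werner_holevo n (uniform_superposition n A) $$ (i, j) = (\<Sum>a<m. \<Sum>k<n. \<Sum>l<n.
        uniform_superposition n A $$ (k, l) * M i k j l $$ (a, a))"
      using ij unfolding snd[OF st, symmetric] M_def
      by (simp add: ptrace_snd_def index_conjugated_tensor_op[OF U quantum_state_carrier[OF st] S]
          del: index_mult_mat)
    also have "\<dots> = (\<Sum>a<m. (\<Sum>k\<in>A. \<Sum>l\<in>A. M i k j l $$ (a, a)) / of_nat (card A))"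
      by (simp add: sum_uniform_superposition[OF A(1)])
    also have "\<dots> = (\<Sum>k\<in>A. \<Sum>a<m. \<Sum>l\<in>A. M i k j l $$ (a, a)) / of_nat (card A)"
      by (simp add: sum_divide_distrib[symmetric] sum.swap[of _ "{..<m}" A])
    also have "\<dots> = (\<Sum>k\<in>A. \<Sum>l\<in>A. T i k j l) / of_nat (card A)"
      by (simp add: T_def trace_op_carrier[OF M] sum.swap[of _ "{..<m}" A])
    finally show ?thesis by simp
  qed
  define c where "c = (1 / (of_nat n - 1) :: complex)"
  have trU: "trace_op (uniform_superposition n A) = 1" if "A \<subseteq> {..<n}" "A \<noteq> {}" for A
    using quantum_state_uniform_superposition[OF that] by (simp add: quantum_state_def)
  have single: "T i k j k = (if i = j \<and> i \<noteq> k then c else 0)" if "i < n" "j < n" "k < n" for i j k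
  proof -
    have "T i k j k = werner_holevo n (uniform_superposition n {k}) $$ (i, j)"
      using that key[of "{k}" i j] by simp
    also have "\<dots> = (if i = j \<and> i \<noteq> k then c else 0)"
      using that by (simp add: werner_holevo_def trU c_def) (simp add: uniform_superposition_def)
    finally show ?thesis .
  qed
  \<comment> \<open>The output for basis state \<open>i\<close> has zero probability at
    \<open>i\<close>, so the block \<open>U\<^sub>i\<^sub>i\<close> has seminorm zero.\<close>
  have diag: "sub_block m U i i * \<sigma> = 0\<^sub>m m m" if "i < n" for i
    using single[of i i i] that mult_eq_0_if_trace_eq_0[OF pos sub_block_carrier[of m U i i]]
    by (simp add: T_def M_def)
  \<comment> \<open>The superposition of \<open>i\<close> and \<open>k\<close> determines only
    \<open>T i i k k + T i k k i\<close>, the remaining two terms being zero by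
    \<open>single\<close>. The first summand drops out because \<open>diag\<close> annihilates
    \<open>U\<^sub>i\<^sub>i\<close>.\<close>
  have cross: "T i k k i = - c" if "i < n" "k < n" "i \<noteq> k" for i k
  proof -
    have z: "T i i k k = 0"
      unfolding T_def M_def diag[OF that(1)] left_mult_zero_mat[OF carrier_mat_adjoint[OF sub_block_carrier]]
      by (simp add: trace_op_def)
    have "werner_holevo n (uniform_superposition n {i, k}) $$ (i, k) = - c / 2"
      using that by (simp add: werner_holevo_def uniform_superposition_def c_def)
    moreover have "(\<Sum>p\<in>{i, k}. \<Sum>q\<in>{i, k}. T i p k q) / of_nat (card {i, k})
        = (T i i k i + T i i k k + T i k k i + T i k k k) / 2"
      using that(3) by (simp add: algebra_simps)
    moreover have "T i i k i = 0" "T i k k k = 0"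
      using single[of i k i] single[of i k k] that by simp_all
    ultimately show ?thesis using key[of "{i, k}" i k] that z by simp
  qed
  show ?thesis
  proof (cases "i = k")
    case True
    then show ?thesis using diag[OF ik(1)] by auto
  next
    case False
    define P Q where "P = sub_block m U i k" and "Q = sub_block m U k i"
    have P: "P \<in> carrier_mat m m" and Q: "Q \<in> carrier_mat m m" by (auto simp: P_def Q_def)
    note PA = carrier_mat_adjoint[OF P] and QA = carrier_mat_adjoint[OF Q]
    note PS = mult_carrier_mat[OF P S] and QS = mult_carrier_mat[OF Q S]
    have adj: "mat_adjoint (P + Q) = mat_adjoint P + mat_adjoint Q"
      using P Q PA QA by (intro eq_matI)
        (auto simp: index_mat_adjoint[OF add_carrier_mat[OF Q]] index_mat_adjoint[OF P] index_mat_adjoint[OF Q])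
    have "(P + Q) * \<sigma> * mat_adjoint (P + Q)
        = (P * \<sigma> * mat_adjoint P + P * \<sigma> * mat_adjoint Q) + (Q * \<sigma> * mat_adjoint P + Q * \<sigma> * mat_adjoint Q)"
      unfolding adj add_mult_distrib_mat[OF P Q S]
      by (simp only: add_mult_distrib_mat[OF PS QS add_carrier_mat[OF QA]]
          mult_add_distrib_mat[OF PS PA QA] mult_add_distrib_mat[OF QS PA QA])
    also have "trace_op \<dots> = (T i k i k + T i k k i) + (T k i i k + T k i k i)"
      unfolding T_def
      using M[of i k i k] M[of i k k i] M[of k i i k] M[of k i k i]
      unfolding M_def P_def[symmetric] Q_def[symmetric]
      by (simp add: trace_op_add[of _ m] del: assoc_mult_mat)
    \<comment> \<open>The four values are \<open>c\<close>, \<open>- c\<close>, \<open>- c\<close>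
      and \<open>c\<close>.\<close>
    also have "\<dots> = 0" using False ik by (simp add: single cross)
    finally have "(P + Q) * \<sigma> = 0\<^sub>m m m" using P Q by (intro mult_eq_0_if_trace_eq_0[OF pos]) auto
    then have z: "P * \<sigma> + Q * \<sigma> = 0\<^sub>m m m" by (simp only: add_mult_distrib_mat[OF P Q S])
    then have "P * \<sigma> = - (Q * \<sigma>)" by (rule eq_uminus_if_add_eq_0_mat[OF PS QS])
    then show ?thesis by (simp add: P_def Q_def)
  qed
qed

text \<open>The purity count, for \<open>A\<close> and \<open>B\<close> two blocks of one column and
  \<open>R\<close> the catalyst output. The two summands of \<open>R\<close> have product zero and
  each squares to an operator of trace \<open>trace_op H / 2\<close>, so twice the purity of
  \<open>R\<close> is that of \<open>\<sigma>\<close>; but the two purities are equal.\<close>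

lemma trace_square_eq_0:
  assumes S: "\<sigma> \<in> carrier_mat m m" and herm: "mat_adjoint \<sigma> = \<sigma>"
    and A: "A \<in> carrier_mat m m" and B: "B \<in> carrier_mat m m" and H: "H \<in> carrier_mat m m"
    and AA: "mat_adjoint (A * \<sigma>) * (A * \<sigma>) = H" and BB: "mat_adjoint (B * \<sigma>) * (B * \<sigma>) = H"
    and AB: "mat_adjoint (A * \<sigma>) * (B * \<sigma>) = 0\<^sub>m m m"
    and HH: "H + H = \<sigma> * \<sigma>"
    and R: "R = A * \<sigma> * mat_adjoint A + B * \<sigma> * mat_adjoint B"
    and tr: "trace_op (R * R) = trace_op (\<sigma> * \<sigma>)"
  shows "trace_op (\<sigma> * \<sigma>) = 0"
proof -
  \<comment> \<open>Since \<open>\<sigma>\<close> is Hermitian, its two inner copies join the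
    neighbouring factors and form the Gram product of \<open>C * \<sigma>\<close> and
    \<open>D * \<sigma>\<close>.\<close>
  have lift: "C * \<sigma> * mat_adjoint C * (D * \<sigma> * mat_adjoint D) =
      C * (mat_adjoint (C * \<sigma>) * (D * \<sigma>)) * mat_adjoint D"
    if C: "C \<in> carrier_mat m m" and D: "D \<in> carrier_mat m m" for C D
  proof -
    note CA = carrier_mat_adjoint[OF C] and DA = carrier_mat_adjoint[OF D]
    show ?thesis
      unfolding mat_adjoint_mult[OF C S] herm
      using C D CA DA S by (simp add: assoc_mult_mat[of _ m m _ m _ m])
  qed
  have BA: "mat_adjoint (B * \<sigma>) * (A * \<sigma>) = 0\<^sub>m m m"
  proof -
    note CA = mult_carrier_mat[OF A S] and CB = mult_carrier_mat[OF B S]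
    have "mat_adjoint (B * \<sigma>) * (A * \<sigma>) = mat_adjoint (mat_adjoint (A * \<sigma>) * (B * \<sigma>))"
      unfolding mat_adjoint_mult[OF carrier_mat_adjoint[OF CA] CB] mat_adjoint_adjoint[OF CA] ..
    also have "\<dots> = 0\<^sub>m m m"
      unfolding AB by (rule eq_matI) (auto simp: index_mat_adjoint[of _ m m])
    finally show ?thesis .
  qed
  \<comment> \<open>Doubling replaces \<open>H\<close> by \<open>\<sigma> * \<sigma> / 2\<close>, up
    to the same factor; one copy of \<open>\<sigma>\<close> then goes to each side, and cyclicity of
    the trace gives back \<open>H\<close>.\<close>
  have dbl: "trace_op (C * H * mat_adjoint C) + trace_op (C * H * mat_adjoint C) = trace_op H"
    if C: "C \<in> carrier_mat m m" and CC: "mat_adjoint (C * \<sigma>) * (C * \<sigma>) = H" for C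
  proof -
    note CA = carrier_mat_adjoint[OF C] and CS = mult_carrier_mat[OF C S] and CH = mult_carrier_mat[OF C H]
    have "trace_op (C * H * mat_adjoint C) + trace_op (C * H * mat_adjoint C)
        = trace_op (C * (H + H) * mat_adjoint C)"
      using mult_carrier_mat[OF CH CA]
      by (simp add: mult_add_distrib_mat[OF C H H] add_mult_distrib_mat[OF CH CH CA] trace_op_add)
    also have "C * (H + H) * mat_adjoint C = C * \<sigma> * mat_adjoint (C * \<sigma>)"
      unfolding HH mat_adjoint_mult[OF C S] herm
      using C CA S by (simp add: assoc_mult_mat[of _ m m _ m _ m])
    also have "trace_op \<dots> = trace_op H"
      unfolding CC[symmetric] by (rule trace_op_mult_comm[OF CS carrier_mat_adjoint[OF CS]])
    finally show ?thesis .
  qed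
  define K L where "K = A * \<sigma> * mat_adjoint A" and "L = B * \<sigma> * mat_adjoint B"
  have K: "K \<in> carrier_mat m m" and L: "L \<in> carrier_mat m m"
    unfolding K_def L_def using A B S by (auto intro!: mult_carrier_mat[of _ m m] carrier_mat_adjoint)
  have KK: "K * K = A * H * mat_adjoint A" unfolding K_def lift[OF A A] AA ..
  have LL: "L * L = B * H * mat_adjoint B" unfolding L_def lift[OF B B] BB ..
  have KL: "K * L = 0\<^sub>m m m" unfolding K_def L_def lift[OF A B] AB
    using A left_mult_zero_mat[OF carrier_mat_adjoint[OF B]] by simp
  have LK: "L * K = 0\<^sub>m m m" unfolding K_def L_def lift[OF B A] BA
    using B left_mult_zero_mat[OF carrier_mat_adjoint[OF A]] by simp
  have "R * R = (K * K + K * L) + (L * K + L * L)"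
    unfolding R K_def[symmetric] L_def[symmetric]
    by (simp only: add_mult_distrib_mat[OF K L add_carrier_mat[OF L]]
        mult_add_distrib_mat[OF K K L] mult_add_distrib_mat[OF L K L])
  also have "\<dots> = K * K + L * L" unfolding KL LK using K L by simp
  finally have "trace_op (R * R) = trace_op (K * K) + trace_op (L * L)"
    using K L by (simp add: trace_op_add[of _ m])
  then have "trace_op (R * R) + trace_op (R * R)
      = (trace_op (K * K) + trace_op (K * K)) + (trace_op (L * L) + trace_op (L * L))" by simp
  also have "\<dots> = trace_op H + trace_op H" unfolding KK LL dbl[OF A AA] dbl[OF B BB] ..
  also have "\<dots> = trace_op (\<sigma> * \<sigma>)" by (simp add: trace_op_add[OF H H, symmetric] HH)
  finally show ?thesis by (simp add: tr)
qed

text \<open>For a Hermitian matrix the trace of the square is the sum of the squared moduli of all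
  entries, so every entry is zero.\<close>

lemma trace_square_hermitian_eq_0:
  assumes S: "\<sigma> \<in> carrier_mat m m" and herm: "mat_adjoint \<sigma> = \<sigma>" and tr: "trace_op (\<sigma> * \<sigma>) = 0"
  shows "trace_op \<sigma> = 0"
proof -
  have "\<sigma> $$ (r, s) * \<sigma> $$ (s, r) = of_real ((cmod (\<sigma> $$ (r, s)))\<^sup>2)" if "r < m" "s < m" for r s
    using index_mat_adjoint[OF S that(2,1)] unfolding herm complex_norm_square by (rule arg_cong)
  then have "trace_op (\<sigma> * \<sigma>) = (\<Sum>r<m. \<Sum>s<m. of_real ((cmod (\<sigma> $$ (r, s)))\<^sup>2))"
    by (simp add: trace_op_carrier[OF mult_carrier_mat[OF S S]] index_mult_sum[OF S S] del: index_mult_mat)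
  also have "\<dots> = of_real (\<Sum>r<m. \<Sum>s<m. (cmod (\<sigma> $$ (r, s)))\<^sup>2)" by simp
  finally have "(\<Sum>r<m. \<Sum>s<m. (cmod (\<sigma> $$ (r, s)))\<^sup>2) = 0"
    using tr by (metis of_real_eq_0_iff)
  then have "\<sigma> $$ (r, s) = 0" if "r < m" "s < m" for r s
    using that by (simp add: sum_nonneg_eq_0_iff sum_nonneg)
  then show ?thesis by (simp add: trace_op_carrier[OF S])
qed

text \<open>Antisymmetry and unitarity supply the hypotheses of \<open>trace_square_eq_0\<close> for
  the blocks \<open>U\<^sub>1\<^sub>0\<close> and \<open>U\<^sub>2\<^sub>0\<close>.\<close>

lemma not_catalytic_werner_holevo: "\<not> catalytic_map 3 (werner_holevo 3)"
proof
  assume "catalytic_map 3 (werner_holevo 3)"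
  then obtain m \<sigma> U V where \<sigma>: "quantum_state m \<sigma>" and Un: "unitary_op (3 * m) U" and V: "unitary_op m V"
    and snd: "\<And>\<rho>. quantum_state 3 \<rho> \<Longrightarrow>
      ptrace_snd 3 m (U * tensor_op \<rho> \<sigma> * mat_adjoint U) = werner_holevo 3 \<rho>"
    and fst: "\<And>\<rho>. quantum_state 3 \<rho> \<Longrightarrow>
      ptrace_fst 3 m (U * tensor_op \<rho> \<sigma> * mat_adjoint U) = V * \<sigma> * mat_adjoint V"
    unfolding catalytic_map_def by blast
  have U: "U \<in> carrier_mat (3 * m) (3 * m)" using Un by (simp add: unitary_op_def)
  have Vc: "V \<in> carrier_mat m m" using V by (simp add: unitary_op_def)
  have S: "\<sigma> \<in> carrier_mat m m" using \<sigma> by (rule quantum_state_carrier)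
  have herm: "mat_adjoint \<sigma> = \<sigma>"
    using \<sigma> by (intro positive_op_hermitian[of m]) (simp add: quantum_state_def)
  define W where "W i k = sub_block m U i k * \<sigma>" for i k
  have W: "W i k \<in> carrier_mat m m" for i k unfolding W_def using S by (intro mult_carrier_mat[of _ m m]) auto
  note WA = carrier_mat_adjoint[OF W]
  have anti: "W i k $$ (a, b) = - W k i $$ (a, b)" if "i < 3" "k < 3" "a < m" "b < m" for i k a b
  proof -
    have "W i k = - W k i" using sub_block_antisym[OF _ \<sigma> U snd that(1,2)] by (simp add: W_def)
    then show ?thesis using that carrier_matD[OF W[of k i]] by simp
  qed
  \<comment> \<open>Entries of the Gram products of the \<open>W i k\<close>, so that the sign
    changes become arithmetic on complex numbers.\<close>
  define G where "G i k j l = (\<lambda>(a, b). \<Sum>c<m. cnj (W i k $$ (c, a)) * W j l $$ (c, b))" for i k j l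
  have G: "(mat_adjoint (W i k) * W j l) $$ (a, b) = G i k j l (a, b)" if "a < m" "b < m" for i k j l a b
    using that by (simp add: G_def index_mult_sum[OF WA W] index_mat_adjoint[OF W] del: index_mult_mat)
  have G1: "G i k j l (a, b) = - G k i j l (a, b)"
    if "i < 3" "k < 3" "a < m" "b < m" for i k j l a b
    using that by (simp add: G_def anti[of i k] sum_negf)
  have G2: "G i k j l (a, b) = - G i k l j (a, b)"
    if "j < 3" "l < 3" "a < m" "b < m" for i k j l a b
    using that by (simp add: G_def anti[of j l] sum_negf)
  \<comment> \<open>Block \<open>(k, l)\<close> of the relation
    \<open>mat_adjoint U * U = 1\<close>, multiplied by \<open>\<sigma>\<close> on both
    sides.\<close>
  have unit: "(\<Sum>i<3. G i k i l (a, b)) = (if k = l then (\<sigma> * \<sigma>) $$ (a, b) else 0)"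
    if kl: "k < 3" "l < 3" and ab: "a < m" "b < m" for k l a b
  proof -
    define E where "E i = mat_adjoint (sub_block m U i k) * sub_block m U i l" for i
    have E: "E i \<in> carrier_mat m m" for i
      unfolding E_def by (intro mult_carrier_mat[of _ m m] carrier_mat_adjoint) auto
    have "(\<Sum>i<3. G i k i l (a, b)) = (\<Sum>i<3. (\<sigma> * E i * \<sigma>) $$ (a, b))"
    proof (intro sum.cong refl)
      fix i
      have "mat_adjoint (W i k) * W i l = \<sigma> * E i * \<sigma>"
        unfolding W_def E_def mat_adjoint_mult[OF sub_block_carrier S] herm
        using S carrier_mat_adjoint[OF sub_block_carrier[of m U i k]]
          mult_carrier_mat[OF sub_block_carrier[of m U i l] S]
        by (simp add: assoc_mult_mat[of _ m m _ m _ m])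
      then show "G i k i l (a, b) = (\<sigma> * E i * \<sigma>) $$ (a, b)" by (simp add: G[OF ab, symmetric])
    qed
    also have "\<dots> = (\<Sum>i<3. \<Sum>d<m. \<Sum>c<m. \<sigma> $$ (a, c) * \<sigma> $$ (d, b) * E i $$ (c, d))"
      using ab by (simp add: index_mult_sum[OF mult_carrier_mat[OF S E] S] index_mult_sum[OF S E]
          sum_distrib_left sum_distrib_right mult_ac del: index_mult_mat)
    also have "\<dots> = (\<Sum>d<m. \<Sum>c<m. \<sigma> $$ (a, c) * \<sigma> $$ (d, b) * (\<Sum>i<3. E i $$ (c, d)))"
      by (simp add: sum_distrib_left sum.swap[of _ "{..<3}"])
    also have "\<dots> = (\<Sum>d<m. \<Sum>c<m. if c = d then (if k = l then \<sigma> $$ (a, d) * \<sigma> $$ (d, b) else 0) else 0)"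
      by (intro sum.cong refl) (simp add: E_def unitary_op_sub_block[OF Un kl] del: index_mult_mat)
    also have "\<dots> = (if k = l then (\<sigma> * \<sigma>) $$ (a, b) else 0)"
      using ab by (simp add: index_mult_sum[OF S S] del: index_mult_mat)
    finally show ?thesis .
  qed
  have three: "{..<3} = {0, 1, 2::nat}" by auto
  define H where "H = mat_adjoint (W 1 0) * W 1 0"
  have H: "H \<in> carrier_mat m m" unfolding H_def by (rule mult_carrier_mat[OF WA W])
  have rel: "G 1 0 1 0 (a, b) = G 2 0 2 0 (a, b)"
    "G 1 0 1 0 (a, b) + G 1 0 1 0 (a, b) = (\<sigma> * \<sigma>) $$ (a, b)" "G 1 0 2 0 (a, b) = 0"
    if ab: "a < m" "b < m" for a b
  proof -
    have z: "G i i j l (a, b) = 0" "G j l i i (a, b) = 0" if "i < 3" for i j l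
      using G1[of i i a b j l] G2[of i i a b j l] that ab by simp_all
    \<comment> \<open>Both factors change sign, so the product does not.\<close>
    have flip: "G i k i l (a, b) = G k i l i (a, b)" if "i < 3" "k < 3" "l < 3" for i k l
      using G1[of i k a b i l] G2[of i l a b k i] that ab by simp
    \<comment> \<open>Each diagonal relation contains two of the three Gram products belonging to
      the unordered index pairs. Three pairwise sums with the same value force all three to equal
      half of it.\<close>
    have e: "G 1 0 1 0 (a, b) + G 2 0 2 0 (a, b) = (\<sigma> * \<sigma>) $$ (a, b)"
      "G 1 0 1 0 (a, b) + G 2 1 2 1 (a, b) = (\<sigma> * \<sigma>) $$ (a, b)"
      "G 2 0 2 0 (a, b) + G 2 1 2 1 (a, b) = (\<sigma> * \<sigma>) $$ (a, b)"
      using unit[of 0 0, OF _ _ ab] unit[of 1 1, OF _ _ ab] unit[of 2 2, OF _ _ ab] z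
        flip[of 0 1 1] flip[of 0 2 2] flip[of 1 2 2]
      unfolding three by simp_all
    \<comment> \<open>In the relation for columns 1 and 2, the rows 1 and 2 contribute a vanishing
      diagonal block, which leaves only row 0.\<close>
    show "G 1 0 2 0 (a, b) = 0"
      using unit[of 1 2, OF _ _ ab] z flip[of 0 1 2] unfolding three by simp
    show *: "G 1 0 1 0 (a, b) = G 2 0 2 0 (a, b)"
      using e(2,3) by (metis add_right_cancel)
    show "G 1 0 1 0 (a, b) + G 1 0 1 0 (a, b) = (\<sigma> * \<sigma>) $$ (a, b)" using e(1) * by simp
  qed
  define R where "R = V * \<sigma> * mat_adjoint V"
  \<comment> \<open>The catalyst output for the basis input 0 sums over the blocks of column 0, and
    the diagonal one vanishes because antisymmetry makes \<open>W 0 0\<close> its own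
    negative.\<close>
  have R: "R = sub_block m U 1 0 * \<sigma> * mat_adjoint (sub_block m U 1 0)
      + sub_block m U 2 0 * \<sigma> * mat_adjoint (sub_block m U 2 0)"
  proof -
    define N where "N i = sub_block m U i 0 * \<sigma> * mat_adjoint (sub_block m U i 0)" for i
    have N: "N i \<in> carrier_mat m m" for i
      unfolding N_def using S by (intro mult_carrier_mat[of _ m m] carrier_mat_adjoint) auto
    have "W 0 0 $$ (a, b) = 0" if "a < m" "b < m" for a b
      using anti[of 0 0 a b] that by simp
    then have "W 0 0 = 0\<^sub>m m m"
      using carrier_matD[OF W[of 0 0]] by (intro eq_matI) auto
    then have N0: "N 0 = 0\<^sub>m m m"
      using left_mult_zero_mat[OF carrier_mat_adjoint[OF sub_block_carrier[of m U 0 0]]]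
      by (simp add: N_def W_def)
    have st: "quantum_state 3 (uniform_superposition 3 {0})" by (rule quantum_state_uniform_superposition) auto
    have "R = N 1 + N 2"
    proof (rule eq_matI)
      fix a b assume "a < dim_row (N 1 + N 2)" "b < dim_col (N 1 + N 2)"
      then have ab: "a < m" "b < m" using N[of 2] by auto
      have "R $$ (a, b) = (\<Sum>i<3. \<Sum>k<3. \<Sum>l<3. uniform_superposition 3 {0} $$ (k, l) *
          (sub_block m U i k * \<sigma> * mat_adjoint (sub_block m U i l)) $$ (a, b))"
        using ab unfolding R_def fst[OF st, symmetric]
        by (simp add: ptrace_fst_def index_conjugated_tensor_op[OF U quantum_state_carrier[OF st] S]
            del: index_mult_mat)
      also have "\<dots> = (\<Sum>i<3. N i $$ (a, b))"
        by (simp add: sum_uniform_superposition N_def)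
      also have "\<dots> = (N 1 + N 2) $$ (a, b)"
        unfolding three using ab N0 N[of 1] N[of 2] by simp
      finally show "R $$ (a, b) = (N 1 + N 2) $$ (a, b)" .
    qed (use N[of 1] N[of 2] Vc in \<open>auto simp: R_def\<close>)
    then show ?thesis by (simp add: N_def)
  qed
  have tr: "trace_op (R * R) = trace_op (\<sigma> * \<sigma>)"
  proof -
    note VA = carrier_mat_adjoint[OF Vc]
    have VV: "mat_adjoint V * V = 1\<^sub>m m" using V by (simp add: unitary_op_def)
    have "R * R = V * \<sigma> * (mat_adjoint V * V) * (\<sigma> * mat_adjoint V)"
      unfolding R_def using Vc VA S by (simp add: assoc_mult_mat[of _ m m _ m _ m])
    also have "\<dots> = V * (\<sigma> * \<sigma> * mat_adjoint V)"
      unfolding VV using Vc VA S by (simp add: assoc_mult_mat[of _ m m _ m _ m])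
    also have "trace_op \<dots> = trace_op (\<sigma> * \<sigma> * mat_adjoint V * V)"
      using Vc VA S by (intro trace_op_mult_comm[of _ m m] mult_carrier_mat[of _ m m]) auto
    also have "\<sigma> * \<sigma> * mat_adjoint V * V = \<sigma> * \<sigma> * (mat_adjoint V * V)"
      using Vc VA S by (simp add: assoc_mult_mat[of _ m m _ m _ m])
    also have "\<dots> = \<sigma> * \<sigma>" unfolding VV using S by simp
    finally show ?thesis .
  qed
  have "trace_op (\<sigma> * \<sigma>) = 0"
  proof (rule trace_square_eq_0[OF S herm sub_block_carrier sub_block_carrier H _ _ _ _ R tr], fold W_def)
    show "mat_adjoint (W 1 0) * W 1 0 = H" by (simp add: H_def)
    show "mat_adjoint (W 2 0) * W 2 0 = H"
      using WA[of 1 0] WA[of 2 0] W[of 1 0] W[of 2 0] unfolding H_def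
      by (intro eq_matI) (simp_all add: G rel(1) del: index_mult_mat(1) One_nat_def)
    show "mat_adjoint (W 1 0) * W 2 0 = 0\<^sub>m m m"
      using WA[of 1 0] W[of 1 0] W[of 2 0]
      by (intro eq_matI) (simp_all add: G rel(3) del: index_mult_mat(1) One_nat_def)
    show "H + H = \<sigma> * \<sigma>"
      using H S WA[of 1 0] W[of 1 0] unfolding H_def
      by (intro eq_matI) (simp_all add: G rel(2) del: index_mult_mat(1) One_nat_def)
  qed
  then have "trace_op \<sigma> = 0" by (rule trace_square_hermitian_eq_0[OF S herm])
  then show False using \<sigma> by (simp add: quantum_state_def)
qed

theorem theorem1:
  shows "\<exists>n \<Phi>. 0 < n \<and> quantum_map n \<Phi> \<and> unital_map n \<Phi> \<and> \<not> catalytic_map n \<Phi>"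
proof (intro exI conjI)
  \<comment> \<open>In dimension 2 this channel is conjugation by a Pauli matrix and hence
    catalytic, so 3 is the first dimension in which it can serve.\<close>
  show "quantum_map 3 (werner_holevo 3)" by (rule quantum_map_werner_holevo) simp
  show "unital_map 3 (werner_holevo 3)" by (rule unital_map_werner_holevo) simp
qed (use not_catalytic_werner_holevo in simp_all)

end
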